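(* Let $A$ and $B$ be $dA_\infty$-algebras. An $\infty$-morphism $f:A\to B$ of $dA_\infty$-algebras is the same thing as a morphism of derived $A_\infty$-algebras in the sense of Sagave, that is, (via $f_{uv}=f(\mu_{uv})$) a collection of maps $f_{uv}:A^{\otimes v}\to B$, $u\ge0$, $v\ge1$, of bidegree $(u,1-u-v)$ satisfying, for all $u\ge0$, $v\ge1$, $$\sum_{\substack{u=i+p,\ v=j+q-1\\ j=1+r+t}}(-1)^{rq+t+pj}f_{ij}(1^{\otimes r}\otimes m^A_{pq}\otimes1^{\otimes t})=\sum_{\substack{u=i+p_1+\cdots+p_j\\ v=q_1+\cdots+q_j}}(-1)^{\sigma}m^B_{ij}(f_{p_1q_1}\otimes\cdots\otimes f_{p_jq_j}),$$ with $\sigma=u+\sum_{k=1}^{j-1}\Big((p_k+q_k)(j+k)+q_k\sum_{s=k+1}^{j}(p_s+q_s)\Big)$.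
   Context: Let $\mathbf{k}$ be a commutative ring. A map of bigraded modules of bidegree $(u,v)$ lowers the horizontal (lower) degree by $u$ and raises the vertical (upper) degree by $v$; Koszul sign rule: $(f\otimes g)(x\otimes y)=(-1)^{pi+qj}f(x)\otimes g(y)$ if $g$ has bidegree $(p,q)$ and $x$ has bidegree $(i,j)$. A $dA_\infty$-algebra is an $(\mathbb{N},\mathbb{Z})$-bigraded $\mathbf{k}$-module $A$ with $\mathbf{k}$-linear maps $m_{ij}:A^{\otimes j}\to A$ of bidegree $(i,2-i-j)$, $i\ge0,j\ge1$, with $\sum_{u=i+p,\,v=j+q-1,\,j=1+r+t}(-1)^{rq+t+pj}m_{ij}(1^{\otimes r}\otimes m_{pq}\otimes1^{\otimes t})=0$ for all $u\ge0,v\ge1$. Vertical bicomplexes are $(\mathbb{N},\mathbb{Z})$-bigraded $\mathbf{k}$-modules with a differential of bidegree $(0,1)$; in this statement $A$ and $B$ are regarded as vertical bicomplexes with $d_A=m^A_{01}$, $d_B=m^B_{01}$. The cooperad $(d\mathcal{A}s)^{¡}$ (the Koszul dual cooperad of the operad $d\mathcal{A}s$ encoding associative monoids in bicomplexes) has zero differential; $(d\mathcal{A}s)^{¡}(n)$ is a free $\mathbf{k}$-module with basis $\mu_{in}$, $i\ge0$, of bidegree $(i,1-i-n)$; $\mu_{01}$ is the identity, and its cocomposition is $$\Delta(\mu_{uv})=\sum_{\substack{i+p_1+\cdots+p_j=u\\ q_1+\cdots+q_j=v}}(-1)^{X}\mu_{ij};\mu_{p_1q_1}\otimes\cdots\otimes\mu_{p_jq_j},\quad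 X=\sum_{k=1}^{j-1}\Big((p_k+q_k)(j+k)+q_k\sum_{l=k+1}^{j}(p_l+q_l)\Big),$$ with infinitesimal cocomposition $\Delta_{(1)}(\mu_{uv})=\sum_{i+p=u,\ r+q+t=v,\ r+1+t=j}(-1)^{r(1-p-q)+pt}\mu_{ij};1^{\otimes r}\otimes\mu_{pq}\otimes1^{\otimes t}$. A $dA_\infty$-structure $m$ on $A$ is equivalent to a square-zero coderivation $D_m$ of degree $+1$ on the cofree $(d\mathcal{A}s)^{¡}$-coalgebra $(d\mathcal{A}s)^{¡}(A)$. An $\infty$-morphism from $(A,m)$ to $(B,m')$ is a morphism of $(d\mathcal{A}s)^{¡}$-coalgebras $F:((d\mathcal{A}s)^{¡}(A),D_m)\to((d\mathcal{A}s)^{¡}(B),D_{m'})$ (commuting with the coderivations). Equivalently, in terms of twisting morphisms: for collections $\mathcal{C},\mathcal{P}$ of vertical bicomplexes, $\mathbf{Hom}(\mathcal{C},\mathcal{P})$ is the complex of maps of bidegree $(0,* )$ (preserving arity and horizontal degree). Let $\mathrm{End}^A_B(n)=\mathrm{Mor}(A^{\otimes n},B)$ be the vertical bicomplex of all bihomogeneous maps, with $\partial(f)=d_Bf-(-1)^j\sum_{v=0}^{n-1}f(1^{\otimes v}\otimes d_A\otimes1^{\otimes n-v-1})$ for $f$ of bidegree $(i,j)$, and $\mathrm{End}_A=\mathrm{End}_A^A$. The $dA_\infty$-structure on $A$ corresponds to the twisting morphism $\varphi_{m^A}\in\mathbf{Hom}((d\mathcal{A}s)^{¡},\mathrm{End}_A)^1$,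 i.e. a solution of $\partial(\varphi)+\varphi\star\varphi=0$ ($\star$ being $\Delta_{(1)}$ followed by $\varphi\circ_{(1)}\varphi$ and composition), with $\varphi_{m^A}(\mu_{01})=0$ and $\varphi_{m^A}(\mu_{ij})=m^A_{ij}$ for $(i,j)\ne(0,1)$; similarly for $B$. An $\infty$-morphism is then equivalent to an element $f\in\mathbf{Hom}((d\mathcal{A}s)^{¡},\mathrm{End}^A_B)$ of degree $0$ such that $f*\varphi_{m^A}-\varphi_{m^B}\circledast f=\partial(f)$, where $f*\varphi$ is $\Delta_{(1)}$ followed by $f\circ_{(1)}\varphi$ and composition of maps, and $\psi\circledast f$ is $\Delta$ followed by $\psi\circ f$ and composition of maps. *)

theory Defs
  imports Complex_Main "HOL-Library.Poly_Mapping"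
begin

section \<open>Bigraded modules\<close>

text \<open>
  A bigraded module is a \<open>'k\<close>-module (scalar multiplication \<open>s\<close> on the type \<open>'a\<close>) that is the
  internal direct sum of submodules \<open>A i j\<close>, with \<open>i\<close> the lower (horizontal) and \<open>j\<close> the upper
  (vertical) degree.
\<close>

definition decomposes ::
  "(nat \<Rightarrow> int \<Rightarrow> 'a::ab_group_add set) \<Rightarrow> (nat \<times> int \<Rightarrow>\<^sub>0 'a) \<Rightarrow> 'a \<Rightarrow> bool" where
  "decomposes A c x \<longleftrightarrow>
     (\<forall>i j. Poly_Mapping.lookup c (i, j) \<in> A i j) \<and>
     x = (\<Sum>d\<in>Poly_Mapping.keys c. Poly_Mapping.lookup c d)"

definition bigraded_module ::
  "('k::comm_ring_1 \<Rightarrow> 'a::ab_group_add \<Rightarrow> 'a) \<Rightarrow> (nat \<Rightarrow> int \<Rightarrow> 'a set) \<Rightarrow> bool" where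
  "bigraded_module s A \<longleftrightarrow>
     module s \<and> (\<forall>i j. module.subspace s (A i j)) \<and> (\<forall>x. \<exists>!c. decomposes A c x)"

definition homogeneous_components ::
  "(nat \<Rightarrow> int \<Rightarrow> 'a::ab_group_add set) \<Rightarrow> 'a \<Rightarrow> (nat \<times> int \<Rightarrow>\<^sub>0 'a)" where
  "homogeneous_components A x = (THE c. decomposes A c x)"

text \<open>The pieces in negative horizontal degree are zero.\<close>

definition piece :: "(nat \<Rightarrow> int \<Rightarrow> 'a::zero set) \<Rightarrow> int \<Rightarrow> int \<Rightarrow> 'a set" where
  "piece A i j = (if i < 0 then {0} else A (nat i) j)"

text \<open>\<open>sg n x\<close> is \<open>(-1)\<^sup>n x\<close>.\<close>

definition sg :: "int \<Rightarrow> 'm::ab_group_add \<Rightarrow> 'm" where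
  "sg n x = (if even n then x else - x)"


section \<open>Multilinear maps and the Koszul sign rule\<close>

text \<open>
  A linear map \<open>A\<^sup>\<otimes>\<^sup>n \<rightarrow> B\<close> is represented by the corresponding multilinear map on lists of length
  \<open>n\<close>, extended by zero to lists of any other length.
\<close>

definition multilinear ::
  "('k::comm_ring_1 \<Rightarrow> 'a::ab_group_add \<Rightarrow> 'a) \<Rightarrow> ('k \<Rightarrow> 'b::ab_group_add \<Rightarrow> 'b) \<Rightarrow> nat \<Rightarrow>
   ('a list \<Rightarrow> 'b) \<Rightarrow> bool" where
  "multilinear sA sB n f \<longleftrightarrow>
     (\<forall>xs. length xs \<noteq> n \<longrightarrow> f xs = 0) \<and>
     (\<forall>xs ys. length xs + 1 + length ys = n \<longrightarrow> module_hom sA sB (\<lambda>x. f (xs @ x # ys)))"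

text \<open>
  \<open>Mor sA A sB B n u v\<close> is the bidegree \<open>(u, v)\<close> piece of \<open>Mor(A\<^sup>\<otimes>\<^sup>n, B) = End\<^sup>A\<^sub>B(n)\<close>: the maps
  lowering the horizontal degree by \<open>u\<close> and raising the vertical degree by \<open>v\<close>.
\<close>

definition Mor ::
  "('k::comm_ring_1 \<Rightarrow> 'a::ab_group_add \<Rightarrow> 'a) \<Rightarrow> (nat \<Rightarrow> int \<Rightarrow> 'a set) \<Rightarrow>
   ('k \<Rightarrow> 'b::ab_group_add \<Rightarrow> 'b) \<Rightarrow> (nat \<Rightarrow> int \<Rightarrow> 'b set) \<Rightarrow>
   nat \<Rightarrow> nat \<Rightarrow> int \<Rightarrow> ('a list \<Rightarrow> 'b) set" where
  "Mor sA A sB B n u v =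
     {f. multilinear sA sB n f \<and>
         (\<forall>xs ds. length xs = n \<longrightarrow> list_all2 (\<lambda>x (i, j). x \<in> A i j) xs ds \<longrightarrow>
            f xs \<in> piece B (int (sum_list (map fst ds)) - int u) (sum_list (map snd ds) + v))}"

text \<open>
  \<open>koszul A p q\<close> is the linear automorphism of \<open>A\<close> that multiplies an element of bidegree \<open>(i, j)\<close>
  by \<open>(-1)\<^sup>p\<^sup>i\<^sup>+\<^sup>q\<^sup>j\<close>: the sign produced when a map of bidegree \<open>(p, q)\<close> passes that element.
\<close>

definition koszul ::
  "(nat \<Rightarrow> int \<Rightarrow> 'a::ab_group_add set) \<Rightarrow> int \<Rightarrow> int \<Rightarrow> 'a \<Rightarrow> 'a" where
  "koszul A p q x =
     (\<Sum>(i, j)\<in>Poly_Mapping.keys (homogeneous_components A x).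
        sg (p * int i + q * j) (Poly_Mapping.lookup (homogeneous_components A x) (i, j)))"

text \<open>
  A map \<open>g : A\<^sup>\<otimes>\<^sup>q \<rightarrow> B\<close> of bidegree \<open>(a, b)\<close> is packed with its arity and bidegree as
  \<open>(q, a, b, g)\<close>.  Applied to the list of the \<open>x\<^sub>k\<close>, \<open>tensor_maps A [g\<^sub>1, \<dots>, g\<^sub>j]\<close> returns the list of
  the tensor factors of \<open>(g\<^sub>1 \<otimes> \<dots> \<otimes> g\<^sub>j)(x\<^sub>1 \<otimes> \<dots> \<otimes> x\<^sub>n)\<close>; the arguments of \<open>g\<^sub>k\<close> are passed by all of
  \<open>g\<^sub>k\<^sub>+\<^sub>1, \<dots>, g\<^sub>j\<close>.
\<close>

type_synonym ('a, 'b) packed_map = "nat \<times> int \<times> int \<times> ('a list \<Rightarrow> 'b)"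

fun tensor_maps ::
  "(nat \<Rightarrow> int \<Rightarrow> 'a::ab_group_add set) \<Rightarrow> ('a, 'b) packed_map list \<Rightarrow> 'a list \<Rightarrow> 'b list" where
  "tensor_maps A [] xs = []"
| "tensor_maps A ((q, a, b, g) # gs) xs =
     g (map (koszul A (\<Sum>(q', a', b', g')\<leftarrow>gs. a') (\<Sum>(q', a', b', g')\<leftarrow>gs. b')) (take q xs))
     # tensor_maps A gs (drop q xs)"

text \<open>\<open>insert_map r h t\<close> is \<open>1\<^sup>\<otimes>\<^sup>r \<otimes> h \<otimes> 1\<^sup>\<otimes>\<^sup>t\<close>.\<close>

definition insert_map ::
  "nat \<Rightarrow> ('a, 'a) packed_map \<Rightarrow> nat \<Rightarrow> ('a, 'a) packed_map list" where
  "insert_map r h t = replicate r (1, 0, 0, hd) @ [h] @ replicate t (1, 0, 0, hd)"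


section \<open>Derived A-infinity algebras\<close>

text \<open>
  The decompositions \<open>u = i + p\<close>, \<open>v = r + q + t\<close> with \<open>q \<ge> 1\<close>; the remaining index is
  \<open>j = r + 1 + t\<close>, so that \<open>v = j + q - 1\<close>.
\<close>

definition partial_indices :: "nat \<Rightarrow> nat \<Rightarrow> (nat \<times> nat \<times> nat \<times> nat \<times> nat) set" where
  "partial_indices u v = {(i, r, p, q, t). i + p = u \<and> r + q + t = v \<and> q \<ge> 1}"

text \<open>
  The decompositions \<open>u = i + p\<^sub>1 + \<dots> + p\<^sub>j\<close>, \<open>v = q\<^sub>1 + \<dots> + q\<^sub>j\<close> with \<open>j \<ge> 1\<close> and all
  \<open>q\<^sub>k \<ge> 1\<close>, encoded as \<open>(i, [(p\<^sub>1, q\<^sub>1), \<dots>, (p\<^sub>j, q\<^sub>j)])\<close>.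
\<close>

definition full_indices :: "nat \<Rightarrow> nat \<Rightarrow> (nat \<times> (nat \<times> nat) list) set" where
  "full_indices u v =
     {(i, w). w \<noteq> [] \<and> (\<forall>(p, q)\<in>set w. q \<ge> 1) \<and>
              i + sum_list (map fst w) = u \<and> sum_list (map snd w) = v}"

definition dA_infty_algebra ::
  "('k::comm_ring_1 \<Rightarrow> 'a::ab_group_add \<Rightarrow> 'a) \<Rightarrow> (nat \<Rightarrow> int \<Rightarrow> 'a set) \<Rightarrow>
   (nat \<Rightarrow> nat \<Rightarrow> 'a list \<Rightarrow> 'a) \<Rightarrow> bool" where
  "dA_infty_algebra s A m \<longleftrightarrow>
     bigraded_module s A \<and>
     (\<forall>i j. j \<ge> 1 \<longrightarrow> m i j \<in> Mor s A s A j i (2 - int i - int j)) \<and>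
     (\<forall>u v xs. v \<ge> 1 \<longrightarrow> length xs = v \<longrightarrow>
        (\<Sum>(i, r, p, q, t)\<in>partial_indices u v.
           sg (int (r * q + t + p * (r + 1 + t)))
             (m i (r + 1 + t)
                (tensor_maps A (insert_map r (q, int p, 2 - int p - int q, m p q) t) xs))) = 0)"


section \<open>The Koszul dual cooperad of dAs\<close>

text \<open>
  For \<open>n \<ge> 1\<close>, the arity \<open>n\<close> component is the free module \<open>nat \<Rightarrow>\<^sub>0 'k\<close> with basis
  \<open>\<mu>\<^sub>u\<^sub>n = mu u\<close>; the component of arity \<open>0\<close> is zero.  The differential is zero.
\<close>

definition fscale :: "'k::comm_ring_1 \<Rightarrow> ('x \<Rightarrow>\<^sub>0 'k) \<Rightarrow> ('x \<Rightarrow>\<^sub>0 'k)" where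
  "fscale a c = Poly_Mapping.map ((*) a) c"

definition mu :: "nat \<Rightarrow> (nat \<Rightarrow>\<^sub>0 'k::comm_ring_1)" where
  "mu u = Poly_Mapping.single u 1"

definition cooperad_piece :: "nat \<Rightarrow> nat \<Rightarrow> int \<Rightarrow> (nat \<Rightarrow>\<^sub>0 'k::comm_ring_1) set" where
  "cooperad_piece n u v =
     (if n \<ge> 1 \<and> v = 1 - int u - int n then range (\<lambda>a. fscale a (mu u)) else {0})"

text \<open>Linear extension of a map given on a basis.\<close>

definition linext ::
  "('k::comm_ring_1 \<Rightarrow> 'm::ab_group_add \<Rightarrow> 'm) \<Rightarrow> ('x \<Rightarrow> 'm) \<Rightarrow> ('x \<Rightarrow>\<^sub>0 'k) \<Rightarrow> 'm" where
  "linext s g c = (\<Sum>b\<in>Poly_Mapping.keys c. s (Poly_Mapping.lookup c b) (g b))"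

text \<open>The sign exponent \<open>X\<close>; the list \<open>w\<close> is 0-based whereas \<open>k\<close> and \<open>l\<close> are 1-based.\<close>

definition X_exponent :: "(nat \<times> nat) list \<Rightarrow> nat" where
  "X_exponent w =
     (let j = length w; p = (\<lambda>k. fst (w ! (k - 1))); q = (\<lambda>k. snd (w ! (k - 1)))
      in \<Sum>k = 1..<j. (p k + q k) * (j + k) + q k * (\<Sum>l = k+1..j. p l + q l))"

text \<open>
  The arity \<open>v\<close> component of the cocomposition.  The basis element
  \<open>\<mu>\<^sub>i\<^sub>j; \<mu>\<^sub>p\<^sub>1\<^sub>q\<^sub>1 \<otimes> \<dots> \<otimes> \<mu>\<^sub>p\<^sub>j\<^sub>q\<^sub>j\<close> of the composite is encoded as
  \<open>(i, [(p\<^sub>1, q\<^sub>1), \<dots>, (p\<^sub>j, q\<^sub>j)])\<close>.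
\<close>

definition cocomposition ::
  "nat \<Rightarrow> (nat \<Rightarrow>\<^sub>0 'k::comm_ring_1) \<Rightarrow> (nat \<times> (nat \<times> nat) list \<Rightarrow>\<^sub>0 'k)" where
  "cocomposition v = linext fscale
     (\<lambda>u. \<Sum>(i, w)\<in>full_indices u v.
        sg (int (X_exponent w)) (Poly_Mapping.single (i, w) 1))"

text \<open>
  The arity \<open>v\<close> component of the infinitesimal cocomposition.  The basis element
  \<open>\<mu>\<^sub>i\<^sub>j; 1\<^sup>\<otimes>\<^sup>r \<otimes> \<mu>\<^sub>p\<^sub>q \<otimes> 1\<^sup>\<otimes>\<^sup>t\<close>, \<open>j = r + 1 + t\<close>, is encoded as \<open>(i, r, p, q, t)\<close>.
\<close>

definition inf_cocomposition ::
  "nat \<Rightarrow> (nat \<Rightarrow>\<^sub>0 'k::comm_ring_1) \<Rightarrow> (nat \<times> nat \<times> nat \<times> nat \<times> nat \<Rightarrow>\<^sub>0 'k)" where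
  "inf_cocomposition v = linext fscale
     (\<lambda>u. \<Sum>(i, r, p, q, t)\<in>partial_indices u v.
        sg (int r * (1 - int p - int q) + int p * int t)
          (Poly_Mapping.single (i, r, p, q, t) 1))"


section \<open>Twisting morphisms and infinity-morphisms\<close>

text \<open>
  \<open>Hom_dAs sA A sB B d\<close> is the degree \<open>d\<close> part of \<open>Hom((dAs)\<^sup>!, End\<^sup>A\<^sub>B)\<close> (Koszul dual cooperad in the
  source): families, indexed by the arity \<open>n\<close>, of linear maps of bidegree \<open>(0, d)\<close>.  As the source
  vanishes in arity \<open>0\<close>, that component is normalised to be the zero function.
\<close>

definition Hom_dAs ::
  "('k::comm_ring_1 \<Rightarrow> 'a::ab_group_add \<Rightarrow> 'a) \<Rightarrow> (nat \<Rightarrow> int \<Rightarrow> 'a set) \<Rightarrow>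
   ('k \<Rightarrow> 'b::ab_group_add \<Rightarrow> 'b) \<Rightarrow> (nat \<Rightarrow> int \<Rightarrow> 'b set) \<Rightarrow> int \<Rightarrow>
   (nat \<Rightarrow> (nat \<Rightarrow>\<^sub>0 'k) \<Rightarrow> 'a list \<Rightarrow> 'b) set" where
  "Hom_dAs sA A sB B d =
     {f. f 0 = (\<lambda>c xs. 0) \<and>
         (\<forall>n\<ge>1. (\<forall>xs. module_hom fscale sB (\<lambda>c. f n c xs)) \<and>
                 (\<forall>u v. \<forall>c\<in>cooperad_piece n u v. f n c \<in> Mor sA A sB B n u (v + d)))}"

text \<open>
  The element of \<open>Hom_dAs s A s A 1\<close> corresponding to the structure \<open>m\<close>; it vanishes on \<open>\<mu>\<^sub>0\<^sub>1\<close> because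
  \<open>m\<^sub>0\<^sub>1\<close> is regarded as the differential of \<open>A\<close>.
\<close>

definition twisting ::
  "('k::comm_ring_1 \<Rightarrow> 'a::ab_group_add \<Rightarrow> 'a) \<Rightarrow> (nat \<Rightarrow> nat \<Rightarrow> 'a list \<Rightarrow> 'a) \<Rightarrow>
   nat \<Rightarrow> (nat \<Rightarrow>\<^sub>0 'k) \<Rightarrow> 'a list \<Rightarrow> 'a" where
  "twisting s m n c xs =
     (if n = 0 then 0
      else linext s (\<lambda>u. if (u, n) = (0, 1) then 0 else m u n xs) c)"

text \<open>
  The differential \<open>d\<^sub>B g - (-1)\<^sup>j \<Sum> g (1\<^sup>\<otimes>\<^sup>v \<otimes> d\<^sub>A \<otimes> 1\<^sup>\<otimes>\<^sup>n\<^sup>-\<^sup>v\<^sup>-\<^sup>1)\<close> on \<open>End\<^sup>A\<^sub>B(n)\<close>, for \<open>g\<close> of vertical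
  degree \<open>j\<close>.
\<close>

definition End_diff ::
  "(nat \<Rightarrow> int \<Rightarrow> 'a::ab_group_add set) \<Rightarrow> ('a list \<Rightarrow> 'a) \<Rightarrow> ('b list \<Rightarrow> 'b) \<Rightarrow>
   nat \<Rightarrow> int \<Rightarrow> ('a list \<Rightarrow> 'b::ab_group_add) \<Rightarrow> 'a list \<Rightarrow> 'b" where
  "End_diff A dA dB n j g xs =
     dB [g xs] - sg j (\<Sum>v<n. g (tensor_maps A (insert_map v (1, 0, 1, dA) (n - v - 1)) xs))"

text \<open>
  The differential of a degree \<open>0\<close> element of \<open>Hom_dAs sA A sB B\<close>.  Since the differential of the
  cooperad is zero, it is postcomposition with the differential of \<open>End\<^sup>A\<^sub>B\<close>, where \<open>f(\<mu>\<^sub>u\<^sub>n)\<close> has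
  vertical degree \<open>1 - u - n\<close>.
\<close>

definition Hom_diff ::
  "(nat \<Rightarrow> int \<Rightarrow> 'a::ab_group_add set) \<Rightarrow> ('k::comm_ring_1 \<Rightarrow> 'b::ab_group_add \<Rightarrow> 'b) \<Rightarrow>
   ('a list \<Rightarrow> 'a) \<Rightarrow> ('b list \<Rightarrow> 'b) \<Rightarrow>
   (nat \<Rightarrow> (nat \<Rightarrow>\<^sub>0 'k) \<Rightarrow> 'a list \<Rightarrow> 'b) \<Rightarrow> nat \<Rightarrow> (nat \<Rightarrow>\<^sub>0 'k) \<Rightarrow> 'a list \<Rightarrow> 'b" where
  "Hom_diff A sB dA dB f n c xs =
     linext sB (\<lambda>u. End_diff A dA dB n (1 - int u - int n) (f n (mu u)) xs) c"

text \<open>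
  \<open>f * \<phi>\<close> for \<open>f\<close> of degree \<open>0\<close> and \<open>\<phi>\<close> of degree \<open>1\<close>: the infinitesimal cocomposition, followed by
  \<open>f \<circ>\<^sub>(\<^sub>1\<^sub>) \<phi>\<close> and composition of maps.  The sign arises from \<open>\<phi>\<close>, of bidegree \<open>(0, 1)\<close>, passing
  \<open>\<mu>\<^sub>i\<^sub>j\<close>, of bidegree \<open>(i, 1 - i - j)\<close>.  The map \<open>\<phi>(\<mu>\<^sub>p\<^sub>q)\<close> has bidegree \<open>(p, 2 - p - q)\<close>.
\<close>

definition star ::
  "(nat \<Rightarrow> int \<Rightarrow> 'a::ab_group_add set) \<Rightarrow> ('k::comm_ring_1 \<Rightarrow> 'b::ab_group_add \<Rightarrow> 'b) \<Rightarrow>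
   (nat \<Rightarrow> (nat \<Rightarrow>\<^sub>0 'k) \<Rightarrow> 'a list \<Rightarrow> 'b) \<Rightarrow> (nat \<Rightarrow> (nat \<Rightarrow>\<^sub>0 'k) \<Rightarrow> 'a list \<Rightarrow> 'a) \<Rightarrow>
   nat \<Rightarrow> (nat \<Rightarrow>\<^sub>0 'k) \<Rightarrow> 'a list \<Rightarrow> 'b" where
  "star A sB f \<phi> n c xs =
     linext sB
       (\<lambda>(i, r, p, q, t).
          sg (1 - int i - int (r + 1 + t))
            (f (r + 1 + t) (mu i)
               (tensor_maps A
                  (insert_map r (q, int p, 2 - int p - int q, \<phi> q (mu p)) t) xs)))
       (inf_cocomposition n c)"

text \<open>
  \<open>\<psi> \<circledast> f\<close> for \<open>\<psi>\<close> of degree \<open>1\<close> and \<open>f\<close> of degree \<open>0\<close>: the cocomposition, followed by \<open>\<psi> \<circ> f\<close> and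
  composition of maps.  As \<open>f\<close> has bidegree \<open>(0, 0)\<close>, \<open>\<psi> \<circ> f\<close> produces no sign.  The map \<open>f(\<mu>\<^sub>p\<^sub>q)\<close>
  has bidegree \<open>(p, 1 - p - q)\<close>.
\<close>

definition circled_ast ::
  "(nat \<Rightarrow> int \<Rightarrow> 'a::ab_group_add set) \<Rightarrow> ('k::comm_ring_1 \<Rightarrow> 'b::ab_group_add \<Rightarrow> 'b) \<Rightarrow>
   (nat \<Rightarrow> (nat \<Rightarrow>\<^sub>0 'k) \<Rightarrow> 'b list \<Rightarrow> 'b) \<Rightarrow> (nat \<Rightarrow> (nat \<Rightarrow>\<^sub>0 'k) \<Rightarrow> 'a list \<Rightarrow> 'b) \<Rightarrow>
   nat \<Rightarrow> (nat \<Rightarrow>\<^sub>0 'k) \<Rightarrow> 'a list \<Rightarrow> 'b" where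
  "circled_ast A sB \<psi> f n c xs =
     linext sB
       (\<lambda>(i, w).
          \<psi> (length w) (mu i)
            (tensor_maps A (map (\<lambda>(p, q). (q, int p, 1 - int p - int q, f q (mu p))) w) xs))
       (cocomposition n c)"

text \<open>
  The infinity-morphisms from \<open>(A, mA)\<close> to \<open>(B, mB)\<close>, in terms of twisting morphisms:
  \<open>f * \<phi>\<^sub>m\<^sub>A - \<phi>\<^sub>m\<^sub>B \<circledast> f = \<partial>(f)\<close>.
\<close>

definition infty_morphisms ::
  "('k::comm_ring_1 \<Rightarrow> 'a::ab_group_add \<Rightarrow> 'a) \<Rightarrow> (nat \<Rightarrow> int \<Rightarrow> 'a set) \<Rightarrow>
   (nat \<Rightarrow> nat \<Rightarrow> 'a list \<Rightarrow> 'a) \<Rightarrow>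
   ('k \<Rightarrow> 'b::ab_group_add \<Rightarrow> 'b) \<Rightarrow> (nat \<Rightarrow> int \<Rightarrow> 'b set) \<Rightarrow>
   (nat \<Rightarrow> nat \<Rightarrow> 'b list \<Rightarrow> 'b) \<Rightarrow>
   (nat \<Rightarrow> (nat \<Rightarrow>\<^sub>0 'k) \<Rightarrow> 'a list \<Rightarrow> 'b) set" where
  "infty_morphisms sA A mA sB B mB =
     {f \<in> Hom_dAs sA A sB B 0.
        \<forall>n\<ge>1. \<forall>c xs. length xs = n \<longrightarrow>
          star A sB f (twisting sA mA) n c xs - circled_ast A sB (twisting sB mB) f n c xs
            = Hom_diff A sB (mA 0 1) (mB 0 1) f n c xs}"


section \<open>Morphisms in the sense of Sagave\<close>

text \<open>The components \<open>g u v\<close> are meaningful for \<open>v \<ge> 1\<close> only; \<open>g u 0\<close> is normalised to be zero.\<close>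

definition sagave_morphisms ::
  "('k::comm_ring_1 \<Rightarrow> 'a::ab_group_add \<Rightarrow> 'a) \<Rightarrow> (nat \<Rightarrow> int \<Rightarrow> 'a set) \<Rightarrow>
   (nat \<Rightarrow> nat \<Rightarrow> 'a list \<Rightarrow> 'a) \<Rightarrow>
   ('k \<Rightarrow> 'b::ab_group_add \<Rightarrow> 'b) \<Rightarrow> (nat \<Rightarrow> int \<Rightarrow> 'b set) \<Rightarrow>
   (nat \<Rightarrow> nat \<Rightarrow> 'b list \<Rightarrow> 'b) \<Rightarrow>
   (nat \<Rightarrow> nat \<Rightarrow> 'a list \<Rightarrow> 'b) set" where
  "sagave_morphisms sA A mA sB B mB =
     {g. (\<forall>u. g u 0 = (\<lambda>xs. 0)) \<and>
         (\<forall>u v. v \<ge> 1 \<longrightarrow> g u v \<in> Mor sA A sB B v u (1 - int u - int v)) \<and>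
         (\<forall>u v xs. v \<ge> 1 \<longrightarrow> length xs = v \<longrightarrow>
            (\<Sum>(i, r, p, q, t)\<in>partial_indices u v.
               sg (int (r * q + t + p * (r + 1 + t)))
                 (g i (r + 1 + t)
                    (tensor_maps A (insert_map r (q, int p, 2 - int p - int q, mA p q) t) xs)))
            =
            (\<Sum>(i, w)\<in>full_indices u v.
               sg (int (u + X_exponent w))
                 (mB i (length w)
                    (tensor_maps A
                       (map (\<lambda>(p, q). (q, int p, 1 - int p - int q, g p q)) w) xs))))}"

end

theory Submission
  imports Defs
begin

text \<open>
  Every operation in the twisting-morphism equation is linear in the cooperad variable, so the
  equation only has to be tested on the basis elements \<open>\<mu>\<^sub>u\<^sub>v\<close>. There it is, up to the factor
  \<open>(-1)\<^sup>u\<close>, Sagave's equation: \<open>\<partial>(f)\<close> supplies exactly the terms with \<open>m\<^sub>0\<^sub>1\<close>, which are missing from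
  the two convolution products because \<open>\<phi>\<^sub>m\<close> vanishes on \<open>\<mu>\<^sub>0\<^sub>1\<close>.
\<close>

section \<open>Signs\<close>

lemma sg_zero [simp]: "sg 0 x = x"
  by (simp add: sg_def)

lemma sg_sg [simp]: "sg m (sg n x) = sg (m + n) x"
  by (simp add: sg_def)

lemma sg_cong: "even (m - n) \<Longrightarrow> sg m x = sg n x"
  by (auto simp: sg_def)

lemma sg_eq_0_iff [simp]: "sg n x = 0 \<longleftrightarrow> x = 0"
  by (simp add: sg_def)

lemma sg_diff: "sg n (x - y) = sg n x - sg n y"
  by (simp add: sg_def)

lemma sg_sum: "sg n (sum f S) = (\<Sum>x\<in>S. sg n (f x))"
  by (simp add: sg_def sum_negf)

lemma (in module_hom) sg: "f (sg n x) = sg n (f x)"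
  by (simp add: sg_def neg)


section \<open>Linear extension\<close>

lemma lookup_fscale [simp]: "Poly_Mapping.lookup (fscale a c) x = a * Poly_Mapping.lookup c x"
  by (simp add: fscale_def map.rep_eq when_def)

lemma module_fscale: "module fscale"
  by unfold_locales (auto intro!: poly_mapping_eqI simp: lookup_add algebra_simps)

text \<open>Coefficients vanish off \<open>keys\<close>, so any finite superset indexes the same
  sum. This lets linear extensions of different elements be compared over one index set, even if
  \<open>keys\<close> shrinks through cancellation.\<close>

lemma linext_superset:
  assumes "module s" "finite S" "Poly_Mapping.keys c \<subseteq> S"
  shows "linext s g c = (\<Sum>b\<in>S. s (Poly_Mapping.lookup c b) (g b))"
proof -
  interpret module s by fact
  show ?thesis
    unfolding linext_def using assms
    by (intro sum.mono_neutral_left) (auto simp: in_keys_iff)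
qed

lemma module_hom_linext:
  assumes "module s"
  shows "module_hom fscale s (linext s g)"
proof -
  interpret module s by fact
  have "linext s g (c + d) = linext s g c + linext s g d" for c d
  proof -
    let ?S = "Poly_Mapping.keys c \<union> Poly_Mapping.keys d"
    have "Poly_Mapping.keys (c + d) \<subseteq> ?S"
      by (rule keys_add)
    then show ?thesis
      by (simp add: linext_superset[OF assms, of ?S] lookup_add scale_left_distrib sum.distrib)
  qed
  moreover have "linext s g (fscale a c) = s a (linext s g c)" for a c
  proof -
    have "Poly_Mapping.keys (fscale a c) \<subseteq> Poly_Mapping.keys c"
      by (auto simp: in_keys_iff)
    then show ?thesis
      by (simp add: linext_superset[OF assms, of "Poly_Mapping.keys c"] scale_sum_right)
  qed
  ultimately show ?thesis
    by (simp add: module_hom_iff assms module_fscale)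
qed

lemma linext_single:
  assumes "module s"
  shows "linext s g (Poly_Mapping.single b 1) = g b"
proof -
  interpret module s by fact
  show ?thesis by (simp add: linext_def)
qed

lemma linext_mu: "module s \<Longrightarrow> linext s g (mu u) = g u"
  by (simp add: mu_def linext_single)

text \<open>The \<open>mu u\<close> form a basis of each arity component, so a linear map is
  recovered from its values on them. This is the uniqueness half of the correspondence.\<close>

lemma module_hom_eq_linext:
  assumes "module_hom fscale s \<phi>"
  shows "\<phi> c = linext s (\<lambda>u. \<phi> (mu u)) c"
proof -
  interpret module_hom fscale s \<phi> by fact
  have "c = (\<Sum>u\<in>Poly_Mapping.keys c. fscale (Poly_Mapping.lookup c u) (mu u))"
    by (rule poly_mapping_eqI)
       (simp add: lookup_sum mu_def lookup_single when_def in_keys_iff if_distrib cong: if_cong)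
  then have "\<phi> c = \<phi> (\<Sum>u\<in>Poly_Mapping.keys c. fscale (Poly_Mapping.lookup c u) (mu u))"
    by simp
  also have "\<dots> = linext s (\<lambda>u. \<phi> (mu u)) c"
    by (simp add: sum scale linext_def)
  finally show ?thesis .
qed

lemma module_hom_eq_0_iff:
  assumes "module_hom fscale s \<phi>"
  shows "(\<forall>c. \<phi> c = 0) \<longleftrightarrow> (\<forall>u. \<phi> (mu u) = 0)"
proof -
  interpret module_hom fscale s \<phi> by fact
  have "\<phi> c = 0" if "\<forall>u. \<phi> (mu u) = 0" for c
    by (subst module_hom_eq_linext[OF assms]) (simp add: that linext_def)
  then show ?thesis
    by blast
qed

text \<open>The nested form is that of \<open>star\<close> and \<open>circled_ast\<close>: the inner
  extension is a cocomposition, the outer one evaluates its output.\<close>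

lemma module_hom_linext_linext:
  assumes "module s"
  shows "module_hom fscale s (\<lambda>c. linext s h (linext fscale k c))"
  using module_hom_compose[OF module_hom_linext[OF module_fscale] module_hom_linext[OF assms]]
  by (simp add: o_def)

lemma linext_linext_mu:
  assumes "module s"
  shows "linext s h (linext fscale (\<lambda>u. \<Sum>x\<in>S u. sg (e x) (Poly_Mapping.single x 1)) (mu u)) =
    (\<Sum>x\<in>S u. sg (e x) (h x))"
proof -
  interpret module_hom fscale s "linext s h" by (rule module_hom_linext) fact
  show ?thesis
    by (simp add: linext_mu module_fscale sum sg linext_single assms)
qed

lemma linext_inf_cocomposition_mu:
  assumes "module s"
  shows "linext s h (inf_cocomposition v (mu u)) =
    (\<Sum>(i, r, p, q, t)\<in>partial_indices u v.
       sg (int r * (1 - int p - int q) + int p * int t) (h (i, r, p, q, t)))"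
  using linext_linext_mu[OF assms, where h = h and S = "\<lambda>u. partial_indices u v" and
      e = "\<lambda>(i, r, p, q, t). int r * (1 - int p - int q) + int p * int t" and u = u]
  by (simp add: inf_cocomposition_def case_prod_unfold)

lemma linext_cocomposition_mu:
  assumes "module s"
  shows "linext s h (cocomposition v (mu u)) =
    (\<Sum>(i, w)\<in>full_indices u v. sg (int (X_exponent w)) (h (i, w)))"
  using linext_linext_mu[OF assms, where h = h and S = "\<lambda>u. full_indices u v" and
      e = "\<lambda>(i, w). int (X_exponent w)" and u = u]
  by (simp add: cocomposition_def case_prod_unfold)


section \<open>Tensor products of maps\<close>

text \<open>A constantly zero factor absorbs whatever Koszul signs act on its arguments. Together
  with multilinearity this kills the terms containing the value of \<open>twisting\<close> on the
  cooperad identity.\<close>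

lemma zero_in_tensor_maps:
  "(q, a, b, \<lambda>_. 0) \<in> set gs \<Longrightarrow> 0 \<in> set (tensor_maps A gs xs)"
  by (induction gs arbitrary: xs) auto

lemma multilinear_zero:
  assumes "multilinear sA sB n f" "0 \<in> set xs"
  shows "f xs = 0"
proof (cases "length xs = n")
  case True
  from assms(2) obtain ys zs where xs: "xs = ys @ 0 # zs"
    by (auto simp: in_set_conv_decomp)
  with assms(1) True have "module_hom sA sB (\<lambda>x. f (ys @ x # zs))"
    by (simp add: multilinear_def)
  from module_hom.zero[OF this] show ?thesis
    by (simp add: xs)
next
  case False
  with assms(1) show ?thesis
    by (simp add: multilinear_def)
qed

lemma multilinear_insert_zero:
  assumes "multilinear sA sB n f"
  shows "f (tensor_maps A (insert_map r (q, a, b, \<lambda>_. 0) t) xs) = 0"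
  by (rule multilinear_zero[OF assms], rule zero_in_tensor_maps[of q a b])
     (simp add: insert_map_def)

text \<open>All signs are trivial, and an element is the sum of its homogeneous components.
  \<open>tensor_maps\<close> applies this automorphism even to the last factor, which is passed by
  no map.\<close>

lemma koszul_zero:
  assumes "bigraded_module s A"
  shows "koszul A 0 0 x = x"
proof -
  have "\<exists>!c. decomposes A c x"
    using assms by (simp add: bigraded_module_def)
  then have "decomposes A (homogeneous_components A x) x"
    unfolding homogeneous_components_def by (rule theI')
  then show ?thesis
    by (simp add: koszul_def decomposes_def case_prod_unfold)
qed

lemma Mor_multilinear: "f \<in> Mor sA A sB B n u v \<Longrightarrow> multilinear sA sB n f"
  by (simp add: Mor_def)

lemma zero_Mor:
  assumes "module sA" "bigraded_module sB B"
  shows "(\<lambda>_. 0) \<in> Mor sA A sB B n u v"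
proof -
  interpret m: module sB using assms(2) by (simp add: bigraded_module_def)
  have "0 \<in> piece B i j" for i j
    using assms(2) m.subspace_0 by (auto simp: piece_def bigraded_module_def)
  then show ?thesis
    by (auto simp: Mor_def multilinear_def module_hom_iff assms(1) m.module_axioms)
qed

text \<open>Commutativity of the ground ring keeps a scaled map linear. Homogeneous elements of the
  cooperad are multiples of some \<open>mu u\<close>, so their images are scaled maps.\<close>

lemma scale_Mor:
  assumes "bigraded_module sB B" "f \<in> Mor sA A sB B n u v"
  shows "(\<lambda>xs. sB a (f xs)) \<in> Mor sA A sB B n u v"
proof -
  interpret m: module sB using assms(1) by (simp add: bigraded_module_def)
  have "sB a y \<in> piece B i j" if "y \<in> piece B i j" for y i j
    using assms(1) that m.subspace_scale by (auto simp: piece_def bigraded_module_def split: if_splits)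
  with assms(2) show ?thesis
    by (auto simp: Mor_def multilinear_def module_hom_iff m.scale_right_distrib mult.commute)
qed


section \<open>The index sets\<close>

lemma finite_partial_indices: "finite (partial_indices u v)"
  by (rule finite_subset[of _ "{..u} \<times> {..v} \<times> {..u} \<times> {..v} \<times> {..v}"])
     (auto simp: partial_indices_def)

lemma finite_full_indices: "finite (full_indices u v)"
proof (rule finite_subset)
  show "full_indices u v \<subseteq> {..u} \<times> {w. set w \<subseteq> {..u} \<times> {..v} \<and> length w \<le> v}"
  proof (clarsimp simp: full_indices_def)
    fix i and w :: "(nat \<times> nat) list"
    assume pos: "\<forall>(p, q)\<in>set w. Suc 0 \<le> q"
    \<comment> \<open>Every arity in \<open>w\<close> is at least 1, so their sum bounds the number
      of factors.\<close>
    have "length w = (\<Sum>x\<leftarrow>w. 1)"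
      by (simp add: sum_list_triv)
    also have "\<dots> \<le> (\<Sum>x\<leftarrow>w. snd x)"
      using pos by (intro sum_list_mono) auto
    finally have "length w \<le> sum_list (map snd w)" .
    moreover have "a \<le> sum_list (map fst w)" "b \<le> sum_list (map snd w)" if "(a, b) \<in> set w" for a b
      using that member_le_sum_list[of a "map fst w"] member_le_sum_list[of b "map snd w"] by force+
    ultimately show "set w \<subseteq> {..i + sum_list (map fst w)} \<times> {..sum_list (map snd w)} \<and>
        length w \<le> sum_list (map snd w)"
      by (auto simp: trans_le_add2)
  qed
  show "finite ({..u} \<times> {w. set w \<subseteq> {..u} \<times> {..v} \<and> length w \<le> v})"
    by (intro finite_cartesian_product finite_lists_length_le) auto
qed

text \<open>Inserting a map of arity 1 and horizontal degree 0 forces \<open>i = u\<close> and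
  \<open>t = v - r - 1\<close>, so only the position \<open>r\<close> is free. These are the terms
  of the differential that involve that of \<open>A\<close>.\<close>

lemma sum_partial_indices_unary:
  "(\<Sum>(i, r, p, q, t)\<in>partial_indices u v. if p = 0 \<and> q = 1 then g i r t else 0) =
     (\<Sum>r<v. g u r (v - r - 1))"
proof -
  have "(\<Sum>(i, r, p, q, t)\<in>partial_indices u v. if p = 0 \<and> q = 1 then g i r t else 0) =
      (\<Sum>(i, r, p, q, t)\<in>{x\<in>partial_indices u v. case x of (i, r, p, q, t) \<Rightarrow> p = 0 \<and> q = 1}. g i r t)"
    using finite_partial_indices
    by (subst sum.inter_filter) (auto intro!: sum.cong)
  also have "\<dots> = (\<Sum>r<v. g u r (v - r - 1))"
    by (rule sum.reindex_bij_witness[of _ "\<lambda>r. (u, r, 0, 1, v - r - 1)" "\<lambda>(i, r, p, q, t). r"])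
       (auto simp: partial_indices_def)
  finally show ?thesis .
qed

text \<open>With a single factor and \<open>i = 0\<close>, that factor carries all of
  \<open>(u, v)\<close>; this index is admissible because \<open>v \<ge> 1\<close>. It yields the
  term of the differential that involves that of \<open>B\<close>.\<close>

lemma sum_full_indices_unary:
  assumes "v \<ge> 1"
  shows "(\<Sum>(i, w)\<in>full_indices u v. if i = 0 \<and> length w = 1 then g w else 0) = g [(u, v)]"
proof -
  have "{x\<in>full_indices u v. case x of (i, w) \<Rightarrow> i = 0 \<and> length w = 1} = {(0, [(u, v)])}"
    using assms by (auto simp: full_indices_def length_Suc_conv)
  moreover have "(\<Sum>(i, w)\<in>full_indices u v. if i = 0 \<and> length w = 1 then g w else 0) =
      (\<Sum>(i, w)\<in>{x\<in>full_indices u v. case x of (i, w) \<Rightarrow> i = 0 \<and> length w = 1}. g w)"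
    using finite_full_indices
    by (subst sum.inter_filter) (auto intro!: sum.cong)
  ultimately show ?thesis
    by simp
qed


section \<open>Comparison of the two equations\<close>

lemma twisting_mu:
  "module s \<Longrightarrow> n \<ge> 1 \<Longrightarrow>
    twisting s m n (mu u) = (if u = 0 \<and> n = 1 then (\<lambda>_. 0) else m u n)"
  by (auto simp: twisting_def linext_mu)

text \<open>An identity between the two defects, not just an equivalence: since they differ by a
  sign, one vanishes exactly when the other does.\<close>

lemma morphism_equations_mu:
  assumes A: "bigraded_module sA A" and B: "module sB"
    and f: "\<And>u n. n \<ge> 1 \<Longrightarrow> multilinear sA sB n (f n (mu u))"
    and v: "v \<ge> 1" "length xs = v"
  shows "star A sB f (twisting sA mA) v (mu u) xs
           - circled_ast A sB (twisting sB mB) f v (mu u) xs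
           - Hom_diff A sB (mA 0 1) (mB 0 1) f v (mu u) xs =
         sg (int u)
          ((\<Sum>(i, r, p, q, t)\<in>partial_indices u v.
              sg (int (r * q + t + p * (r + 1 + t)))
                (f (r + 1 + t) (mu i)
                  (tensor_maps A (insert_map r (q, int p, 2 - int p - int q, mA p q) t) xs)))
           - (\<Sum>(i, w)\<in>full_indices u v.
               sg (int (u + X_exponent w))
                 (mB i (length w)
                   (tensor_maps A (map (\<lambda>(p, q). (q, int p, 1 - int p - int q, f q (mu p))) w) xs))))"
    (is "?star - ?circ - ?diff = sg _ (?L - ?R)")
proof -
  have sA: "module sA"
    using A by (simp add: bigraded_module_def)
  define T where "T = (\<lambda>i r p q t. f (r + 1 + t) (mu i)
    (tensor_maps A (insert_map r (q, int p, 2 - int p - int q, mA p q) t) xs))"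
  define S where "S = (\<lambda>i w. mB i (length w)
    (tensor_maps A (map (\<lambda>(p, q). (q, int p, 1 - int p - int q, f q (mu p))) w) xs))"
  let ?n = "\<lambda>r p q t. int (r * q + t + p * (r + 1 + t))"
  have star: "?star = (\<Sum>(i, r, p, q, t)\<in>partial_indices u v.
      if p = 0 \<and> q = 1 then 0 else sg (int u + ?n r p q t) (T i r p q t))"
    unfolding star_def linext_inf_cocomposition_mu[OF B]
  proof (rule sum.cong[OF refl], unfold split_paired_all prod.case sg_sg)
    fix i r p q t
    assume "(i, r, p, q, t) \<in> partial_indices u v"
    then have u: "u = i + p" and q: "q \<ge> 1"
      by (auto simp: partial_indices_def)
    \<comment> \<open>The exponent from the infinitesimal cocomposition plus the one from the degree
      1 map passing the outer cooperad element. It has the parity of Sagave's exponent plus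
      \<open>u\<close>.\<close>
    let ?m = "int r * (1 - int p - int q) + int p * int t + (1 - int i - int (r + 1 + t))"
    show "sg ?m (f (r + 1 + t) (mu i) (tensor_maps A
              (insert_map r (q, int p, 2 - int p - int q, twisting sA mA q (mu p)) t) xs)) =
      (if p = 0 \<and> q = 1 then 0 else sg (int u + ?n r p q t) (T i r p q t))"
    proof (cases "p = 0 \<and> q = 1")
      case True
      then show ?thesis
        using multilinear_insert_zero[OF f, of "r + 1 + t"] by (simp add: twisting_mu sA)
    next
      case False
      have "?m - (int u + ?n r p q t) =
          2 * (- int r * int p - int r * int q - int i - int p - int t)"
        by (simp add: u algebra_simps)
      then have "even (?m - (int u + ?n r p q t))"
        by (simp only: dvd_triv_left)
      note sign = sg_cong[OF this]
      have "twisting sA mA q (mu p) = mA p q"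
        using twisting_mu[OF sA q] False by auto
      with False show ?thesis
        unfolding T_def sign by auto
    qed
  qed
  have circ: "?circ = (\<Sum>(i, w)\<in>full_indices u v.
      if i = 0 \<and> length w = 1 then 0 else sg (int (X_exponent w)) (S i w))"
    unfolding circled_ast_def linext_cocomposition_mu[OF B]
  proof (rule sum.cong[OF refl], unfold split_paired_all prod.case)
    fix i and w :: "(nat \<times> nat) list"
    assume "(i, w) \<in> full_indices u v"
    then have "length w \<ge> 1"
      by (cases w) (auto simp: full_indices_def)
    then show "sg (int (X_exponent w)) (twisting sB mB (length w) (mu i) (tensor_maps A
              (map (\<lambda>(p, q). (q, int p, 1 - int p - int q, f q (mu p))) w) xs)) =
      (if i = 0 \<and> length w = 1 then 0 else sg (int (X_exponent w)) (S i w))"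
      by (simp add: twisting_mu B S_def)
  qed
  \<comment> \<open>For \<open>p = 0\<close> and \<open>q = 1\<close> the exponent is
    \<open>r + t = v - 1\<close>, so the split-off terms share one sign, independent of
    \<open>r\<close>.\<close>
  have L: "sg (int u) ?L = ?star + sg (int u + int v - 1) (\<Sum>r<v. T u r 0 1 (v - r - 1))"
  proof -
    have "sg (int u) ?L = (\<Sum>(i, r, p, q, t)\<in>partial_indices u v. sg (int u + ?n r p q t) (T i r p q t))"
      by (simp add: sg_sum T_def case_prod_unfold)
    also have "\<dots> = ?star + (\<Sum>(i, r, p, q, t)\<in>partial_indices u v.
        if p = 0 \<and> q = 1 then sg (int u + ?n r 0 1 t) (T i r 0 1 t) else 0)"
      unfolding star sum.distrib[symmetric] by (intro sum.cong) auto
    also have "(\<Sum>(i, r, p, q, t)\<in>partial_indices u v.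
        if p = 0 \<and> q = 1 then sg (int u + ?n r 0 1 t) (T i r 0 1 t) else 0) =
      (\<Sum>r<v. sg (int u + int v - 1) (T u r 0 1 (v - r - 1)))"
      unfolding sum_partial_indices_unary by (intro sum.cong sg_cong) auto
    finally show ?thesis
      by (simp add: sg_sum)
  qed
  \<comment> \<open>The factor cancels the summand \<open>u\<close> of Sagave's exponent. For one
    factor \<open>X_exponent\<close> is an empty sum, so the split-off term has sign +1.\<close>
  have R: "sg (int u) ?R = ?circ + S 0 [(u, v)]"
  proof -
    have "sg (int u) ?R = (\<Sum>(i, w)\<in>full_indices u v. sg (int (X_exponent w)) (S i w))"
      unfolding sg_sum by (intro sum.cong) (auto simp: S_def intro!: sg_cong)
    also have "\<dots> = ?circ + (\<Sum>(i, w)\<in>full_indices u v.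
        if i = 0 \<and> length w = 1 then sg (int (X_exponent w)) (S 0 w) else 0)"
      unfolding circ sum.distrib[symmetric] by (intro sum.cong) auto
    also have "(\<Sum>(i, w)\<in>full_indices u v.
        if i = 0 \<and> length w = 1 then sg (int (X_exponent w)) (S 0 w) else 0) = S 0 [(u, v)]"
      unfolding sum_full_indices_unary[OF v(1)] by (simp add: X_exponent_def)
    finally show ?thesis .
  qed
  \<comment> \<open>The vertical degree \<open>1 - u - v\<close> in \<open>End_diff\<close> has the
    parity of \<open>u + v - 1\<close>, so the differential consists exactly of the terms split off
    in \<open>R\<close> and \<open>L\<close>.\<close>
  have diff: "?diff = S 0 [(u, v)] - sg (int u + int v - 1) (\<Sum>r<v. T u r 0 1 (v - r - 1))"
  proof -
    have "map (koszul A 0 0) xs = xs"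
      by (simp add: koszul_zero[OF A] map_idI)
    moreover have "(\<Sum>r<v. f v (mu u) (tensor_maps A (insert_map r (1, 0, 1, mA 0 1) (v - r - 1)) xs)) =
        (\<Sum>r<v. T u r 0 1 (v - r - 1))"
      by (intro sum.cong) (auto simp: T_def)
    ultimately show ?thesis
      using v(2) by (simp add: Hom_diff_def linext_mu B End_diff_def S_def) (rule sg_cong, simp)
  qed
  show ?thesis
    unfolding sg_diff L R diff by simp
qed

section \<open>Elements of \<open>Hom_dAs\<close> and families of bihomogeneous maps\<close>

lemma Hom_dAs_mu_Mor:
  assumes "f \<in> Hom_dAs sA A sB B 0" "n \<ge> 1"
  shows "f n (mu u) \<in> Mor sA A sB B n u (1 - int u - int n)"
proof -
  have "mu u = fscale 1 (mu u)"
    by (simp add: module.scale_one[OF module_fscale])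
  then have "mu u \<in> cooperad_piece n u (1 - int u - int n)"
    using assms(2) by (auto simp: cooperad_piece_def)
  with assms show ?thesis
    by (force simp: Hom_dAs_def)
qed

text \<open>For fixed arguments \<open>xs\<close> the defect of the twisting equation is linear in
  the cooperad element, so it vanishes identically once it vanishes on the basis.\<close>

lemma morphism_equations_iff:
  assumes A: "bigraded_module sA A" and B: "module sB"
    and f: "f \<in> Hom_dAs sA A sB B 0"
    and v: "v \<ge> 1" "length xs = v"
  shows "(\<forall>c. star A sB f (twisting sA mA) v c xs - circled_ast A sB (twisting sB mB) f v c xs =
              Hom_diff A sB (mA 0 1) (mB 0 1) f v c xs) \<longleftrightarrow>
         (\<forall>u. (\<Sum>(i, r, p, q, t)\<in>partial_indices u v.
              sg (int (r * q + t + p * (r + 1 + t)))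
                (f (r + 1 + t) (mu i)
                  (tensor_maps A (insert_map r (q, int p, 2 - int p - int q, mA p q) t) xs)))
           = (\<Sum>(i, w)\<in>full_indices u v.
               sg (int (u + X_exponent w))
                 (mB i (length w)
                   (tensor_maps A (map (\<lambda>(p, q). (q, int p, 1 - int p - int q, f q (mu p))) w) xs))))"
proof -
  note mul = Mor_multilinear[OF Hom_dAs_mu_Mor[OF f]]
  interpret module_pair fscale sB
    using module_fscale B by (simp add: module_pair_def)
  let ?\<phi> = "\<lambda>c. star A sB f (twisting sA mA) v c xs
    - circled_ast A sB (twisting sB mB) f v c xs - Hom_diff A sB (mA 0 1) (mB 0 1) f v c xs"
  have "module_hom fscale sB ?\<phi>"
    unfolding star_def circled_ast_def Hom_diff_def inf_cocomposition_def cocomposition_def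
    by (intro module_hom_sub module_hom_linext_linext module_hom_linext B)
  from module_hom_eq_0_iff[OF this] show ?thesis
    by (simp add: morphism_equations_mu[where f = f, OF A B mul v] del: One_nat_def)
qed

text \<open>Existence half of the correspondence. A homogeneous piece of the cooperad either
  consists of the multiples of \<open>mu u\<close>, where the degree condition on \<open>g\<close>
  applies, or is zero.\<close>

lemma linext_in_Hom_dAs:
  assumes A: "module sA" and B: "bigraded_module sB B"
    and g: "\<And>u v. v \<ge> 1 \<Longrightarrow> g u v \<in> Mor sA A sB B v u (1 - int u - int v)"
  shows "(\<lambda>n c xs. if n = 0 then 0 else linext sB (\<lambda>u. g u n xs) c) \<in> Hom_dAs sA A sB B 0"
proof -
  have sB: "module sB"
    using B by (simp add: bigraded_module_def)
  have "(\<lambda>xs. linext sB (\<lambda>u. g u n xs) c) \<in> Mor sA A sB B n u v"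
    if n: "n \<ge> 1" and c: "c \<in> cooperad_piece n u v" for n u v c
  proof (cases "v = 1 - int u - int n")
    case True
    with n c obtain a where "c = fscale a (mu u)"
      by (auto simp: cooperad_piece_def)
    then show ?thesis
      using scale_Mor[OF B g[OF n]] True
      by (simp add: module_hom.scale[OF module_hom_linext[OF sB]] linext_mu sB)
  next
    case False
    then show ?thesis
      using c zero_Mor[OF A B]
      by (simp add: cooperad_piece_def module_hom.zero[OF module_hom_linext[OF sB]])
  qed
  then show ?thesis
    by (auto simp: Hom_dAs_def module_hom_linext sB)
qed

theorem theorem4p4:
  fixes sA :: "'k::comm_ring_1 \<Rightarrow> 'a::ab_group_add \<Rightarrow> 'a"
    and A :: "nat \<Rightarrow> int \<Rightarrow> 'a set"
    and mA :: "nat \<Rightarrow> nat \<Rightarrow> 'a list \<Rightarrow> 'a"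
    and sB :: "'k \<Rightarrow> 'b::ab_group_add \<Rightarrow> 'b"
    and B :: "nat \<Rightarrow> int \<Rightarrow> 'b set"
    and mB :: "nat \<Rightarrow> nat \<Rightarrow> 'b list \<Rightarrow> 'b"
  assumes "dA_infty_algebra sA A mA"
    and "dA_infty_algebra sB B mB"
  shows "bij_betw (\<lambda>f u v. f v (mu u))
           (infty_morphisms sA A mA sB B mB)
           (sagave_morphisms sA A mA sB B mB)"
proof -
  have A: "bigraded_module sA A" and B: "bigraded_module sB B"
    using assms by (simp_all add: dA_infty_algebra_def)
  then have sA: "module sA" and sB: "module sB"
    by (simp_all add: bigraded_module_def)
  let ?to = "\<lambda>(f :: nat \<Rightarrow> (nat \<Rightarrow>\<^sub>0 'k) \<Rightarrow> 'a list \<Rightarrow> 'b) u v. f v (mu u)"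
  \<comment> \<open>The inverse is linear extension from the basis; arity 0 is set to zero to match
    the normalisation in \<open>Hom_dAs\<close>.\<close>
  let ?from = "\<lambda>g n c xs. if n = 0 then 0 else linext sB (\<lambda>u. g u n xs) c"
  have equations: "f \<in> infty_morphisms sA A mA sB B mB \<longleftrightarrow> ?to f \<in> sagave_morphisms sA A mA sB B mB"
    if f: "f \<in> Hom_dAs sA A sB B 0" for f
  proof -
    note Mor = Hom_dAs_mu_Mor[OF f]
    note iff = morphism_equations_iff[OF A sB f]
    have zero: "f 0 (mu u) = (\<lambda>xs. 0)" for u
      using f by (simp add: Hom_dAs_def)
    show ?thesis
    proof
      assume "f \<in> infty_morphisms sA A mA sB B mB"
      then have eq: "\<forall>c. star A sB f (twisting sA mA) v c xs - circled_ast A sB (twisting sB mB) f v c xs =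
          Hom_diff A sB (mA 0 1) (mB 0 1) f v c xs" if "v \<ge> 1" "length xs = v" for v xs
        using that by (simp add: infty_morphisms_def)
      show "?to f \<in> sagave_morphisms sA A mA sB B mB"
        unfolding sagave_morphisms_def mem_Collect_eq
        by (intro conjI allI impI zero Mor, assumption)
           (rule iff[THEN iffD1, THEN spec], assumption+, rule eq, assumption+)
    next
      assume "?to f \<in> sagave_morphisms sA A mA sB B mB"
      then have "\<forall>c. star A sB f (twisting sA mA) v c xs - circled_ast A sB (twisting sB mB) f v c xs =
          Hom_diff A sB (mA 0 1) (mB 0 1) f v c xs" if "v \<ge> 1" "length xs = v" for v xs
        unfolding iff[OF that] using that by (simp add: sagave_morphisms_def)
      with f show "f \<in> infty_morphisms sA A mA sB B mB"
        by (simp add: infty_morphisms_def)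
    qed
  qed
  \<comment> \<open>In arity 0 both sides are zero by the normalisation of
    \<open>sagave_morphisms\<close>; elsewhere linear extension returns the prescribed value on
    \<open>mu u\<close>.\<close>
  have to_from: "?to (?from g) = g" if "g \<in> sagave_morphisms sA A mA sB B mB" for g
    using that by (auto simp: sagave_morphisms_def linext_mu sB fun_eq_iff)
  show ?thesis
  proof (rule bij_betw_byWitness[where f' = ?from])
    show "\<forall>f\<in>infty_morphisms sA A mA sB B mB. ?from (?to f) = f"
    proof (intro ballI ext)
      fix f n c xs
      assume "f \<in> infty_morphisms sA A mA sB B mB"
      then show "?from (?to f) n c xs = f n c xs"
        using module_hom_eq_linext[of sB "\<lambda>c. f n c xs" c]
        by (simp add: infty_morphisms_def Hom_dAs_def)
    qed
    show "\<forall>g\<in>sagave_morphisms sA A mA sB B mB. ?to (?from g) = g"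
      using to_from by (rule ballI)
    show "?to ` infty_morphisms sA A mA sB B mB \<subseteq> sagave_morphisms sA A mA sB B mB"
      using equations by (auto simp: infty_morphisms_def)
    show "?from ` sagave_morphisms sA A mA sB B mB \<subseteq> infty_morphisms sA A mA sB B mB"
    proof (rule image_subsetI)
      fix g assume g: "g \<in> sagave_morphisms sA A mA sB B mB"
      then have "?from g \<in> Hom_dAs sA A sB B 0"
        by (intro linext_in_Hom_dAs sA B) (simp add: sagave_morphisms_def)
      then show "?from g \<in> infty_morphisms sA A mA sB B mB"
        \<comment> \<open>As \<open>?from g\<close> lies in \<open>Hom_dAs\<close>,
          \<open>equations\<close> reduces the claim to its components, which are \<open>g\<close>
          again.\<close>
        using g to_from[OF g] by (subst equations) simp_all
    qed
  qed
qed

end
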